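(* Fix $t$. In the coverage game described in the context, define $\bar V_k(t) := \sum_{s\in\mathcal A} C_{ks} V(s,t)$. Then the game with utilities $U_{ik}$ is an exact potential game with potential $$W(\boldsymbol a,t):= \sum_{i=1}^N \bar V_{a_i}(t)- \frac{\rho}{2}\sum_{i\neq j} C_{a_i,a_j},$$ where the second sum is over ordered pairs $(i,j)$ of distinct agents. Consequently, $\boldsymbol a^\star\in\mathcal A^N$ is a projected Nash equilibrium if and only if it is a local maximizer of $W(\cdot,t)$.
   Context: There are $N$ agents $\{1,\dots,N\}$ with common finite action set $\mathcal A=\{1,\dots,K\}$, viewed as sectors on a discrete ring with angles $\theta_k=2\pi k/K$. The event density is $V:\mathcal A\times\mathbb R_{\ge0}\to\mathbb R_{\ge0}$ with $\sum_kV(k,t)=1$. Given a joint action profile $\boldsymbol a=(a_1,\dots,a_N)\in\mathcal A^N$, agent $i$ observes the evidence $b_{ik}(t)=V(k,t)-\rho\sum_{j\ne i}\mathbf 1[a_j=k]$, with $\rho>0$. Let $k_\star$ be the index of the (unique) dominant Fourier mode of a fixed symmetric circulant action-coupling matrix $A\in\mathbb R^{K\times K}$, and let $C_{ks}=\cos(k_\star(\theta_s-\theta_k))$. The effective utility of action $k$ to agent $i$ is $$U_{ik}(\boldsymbol a_{-i},t)=\sum_{s\in\mathcal A}C_{ks}\,b_{is}(t),$$ where $\boldsymbol a_{-i}$ is the profile of the agents other than $i$; thus agent $i$'s payoff at profile $\boldsymbol a$ is $U_i(a_i,\boldsymbol a_{-i},t)=U_{i a_i}(\boldsymbol a_{-i},t)$.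 Exact potential game: for every agent $i$, all $a_i,a_i'\in\mathcal A$ and all $\boldsymbol a_{-i}$, $W(a_i',\boldsymbol a_{-i},t)-W(a_i,\boldsymbol a_{-i},t)=U_i(a_i',\boldsymbol a_{-i},t)-U_i(a_i,\boldsymbol a_{-i},t)$. Projected Nash equilibrium: $a_i^\star\in\arg\max_{k\in\mathcal A}U_{ik}(\boldsymbol a^\star_{-i},t)$ for every $i$. Local maximizer of $W(\cdot,t)$: a profile at which no unilateral change of a single agent's action increases $W(\cdot,t)$. *)

theory Defs
  imports "HOL-Analysis.Analysis"
begin

definition agents :: "nat \<Rightarrow> nat set" where
  "agents N = {1..N}"

definition actions :: "nat \<Rightarrow> nat set" where
  "actions K = {1..K}"

definition profiles :: "nat \<Rightarrow> nat \<Rightarrow> (nat \<Rightarrow> nat) set" where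
  "profiles N K = agents N \<rightarrow>\<^sub>E actions K"

definition others :: "nat \<Rightarrow> nat \<Rightarrow> (nat \<Rightarrow> nat) \<Rightarrow> nat \<Rightarrow> nat" where
  "others N i a = restrict a (agents N - {i})"

definition angle :: "nat \<Rightarrow> nat \<Rightarrow> real" where
  "angle K k = 2 * pi * real k / real K"

text \<open>A matrix is a function of two indices, of which only the values on \<open>actions K\<close> matter.\<close>

definition symmetric_circulant :: "nat \<Rightarrow> (nat \<Rightarrow> nat \<Rightarrow> real) \<Rightarrow> bool" where
  "symmetric_circulant K A \<longleftrightarrow>
     (\<forall>k\<in>actions K. \<forall>s\<in>actions K. A k s = A s k) \<and>
     (\<exists>c :: int \<Rightarrow> real. \<forall>k\<in>actions K. \<forall>s\<in>actions K. A k s = c ((int s - int k) mod int K))"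

text \<open>The eigenvalue of a circulant matrix for the Fourier vector with entries
  \<open>cis (m * angle K s)\<close>, read off from the first row.\<close>

definition fourier_eigenvalue :: "nat \<Rightarrow> (nat \<Rightarrow> nat \<Rightarrow> real) \<Rightarrow> nat \<Rightarrow> complex" where
  "fourier_eigenvalue K A m =
     (\<Sum>s\<in>actions K. complex_of_real (A 1 s) * cis (real m * (angle K s - angle K 1)))"

text \<open>For symmetric circulant matrices the eigenvalues are real, and the modes \<open>m\<close> and
  \<open>K - m\<close> share theirs, so uniqueness can only be required up to this conjugation; both indices
  also give the same \<open>coupling\<close> below.  The function \<open>strength\<close> ranks the modes: \<open>Re\<close> selects the
  largest eigenvalue, \<open>cmod\<close> the one of largest modulus.\<close>

definition unique_dominant_mode ::
    "(complex \<Rightarrow> real) \<Rightarrow> nat \<Rightarrow> (nat \<Rightarrow> nat \<Rightarrow> real) \<Rightarrow> nat \<Rightarrow> bool" where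
  "unique_dominant_mode strength K A kstar \<longleftrightarrow>
     kstar < K \<and>
     (\<forall>m<K. m \<noteq> kstar \<and> m + kstar \<noteq> K \<longrightarrow>
        strength (fourier_eigenvalue K A m) < strength (fourier_eigenvalue K A kstar))"

definition coupling :: "nat \<Rightarrow> nat \<Rightarrow> nat \<Rightarrow> nat \<Rightarrow> real" where
  "coupling K kstar k s = cos (real kstar * (angle K s - angle K k))"

definition event_density :: "nat \<Rightarrow> (nat \<Rightarrow> real \<Rightarrow> real) \<Rightarrow> bool" where
  "event_density K V \<longleftrightarrow>
     (\<forall>t\<ge>0. (\<forall>k\<in>actions K. 0 \<le> V k t) \<and> (\<Sum>k\<in>actions K. V k t) = 1)"

text \<open>In \<open>evidence\<close> and \<open>utility\<close>, \<open>b\<close> is the profile of the agents other than \<open>i\<close>.\<close>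

definition evidence ::
    "nat \<Rightarrow> real \<Rightarrow> (nat \<Rightarrow> real \<Rightarrow> real) \<Rightarrow> nat \<Rightarrow> nat \<Rightarrow> (nat \<Rightarrow> nat) \<Rightarrow> real \<Rightarrow> real" where
  "evidence N \<rho> V i k b t = V k t - \<rho> * (\<Sum>j\<in>agents N - {i}. if b j = k then 1 else 0)"

definition utility ::
    "nat \<Rightarrow> nat \<Rightarrow> nat \<Rightarrow> real \<Rightarrow> (nat \<Rightarrow> real \<Rightarrow> real) \<Rightarrow> nat \<Rightarrow> nat \<Rightarrow> (nat \<Rightarrow> nat) \<Rightarrow> real \<Rightarrow> real" where
  "utility N K kstar \<rho> V i k b t =
     (\<Sum>s\<in>actions K. coupling K kstar k s * evidence N \<rho> V i s b t)"

definition payoff ::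
    "nat \<Rightarrow> nat \<Rightarrow> nat \<Rightarrow> real \<Rightarrow> (nat \<Rightarrow> real \<Rightarrow> real) \<Rightarrow> nat \<Rightarrow> (nat \<Rightarrow> nat) \<Rightarrow> real \<Rightarrow> real" where
  "payoff N K kstar \<rho> V i a t = utility N K kstar \<rho> V i (a i) (others N i a) t"

definition exact_potential ::
    "nat \<Rightarrow> nat \<Rightarrow> (nat \<Rightarrow> (nat \<Rightarrow> nat) \<Rightarrow> real) \<Rightarrow> ((nat \<Rightarrow> nat) \<Rightarrow> real) \<Rightarrow> bool" where
  "exact_potential N K u W \<longleftrightarrow>
     (\<forall>i\<in>agents N. \<forall>x\<in>actions K. \<forall>y\<in>actions K. \<forall>b\<in>(agents N - {i}) \<rightarrow>\<^sub>E actions K.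
        W (b(i := y)) - W (b(i := x)) = u i (b(i := y)) - u i (b(i := x)))"

definition projected_nash ::
    "nat \<Rightarrow> nat \<Rightarrow> nat \<Rightarrow> real \<Rightarrow> (nat \<Rightarrow> real \<Rightarrow> real) \<Rightarrow> real \<Rightarrow> (nat \<Rightarrow> nat) \<Rightarrow> bool" where
  "projected_nash N K kstar \<rho> V t a \<longleftrightarrow>
     (\<forall>i\<in>agents N.
        is_arg_max (\<lambda>k. utility N K kstar \<rho> V i k (others N i a) t) (\<lambda>k. k \<in> actions K) (a i))"

definition local_maximizer :: "nat \<Rightarrow> nat \<Rightarrow> ((nat \<Rightarrow> nat) \<Rightarrow> real) \<Rightarrow> (nat \<Rightarrow> nat) \<Rightarrow> bool" where
  "local_maximizer N K W a \<longleftrightarrow>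
     \<not> (\<exists>i\<in>agents N. \<exists>x\<in>actions K. W a < W (a(i := x)))"

definition Vbar :: "nat \<Rightarrow> nat \<Rightarrow> (nat \<Rightarrow> real \<Rightarrow> real) \<Rightarrow> nat \<Rightarrow> real \<Rightarrow> real" where
  "Vbar K kstar V k t = (\<Sum>s\<in>actions K. coupling K kstar k s * V s t)"

definition potential ::
    "nat \<Rightarrow> nat \<Rightarrow> nat \<Rightarrow> real \<Rightarrow> (nat \<Rightarrow> real \<Rightarrow> real) \<Rightarrow> (nat \<Rightarrow> nat) \<Rightarrow> real \<Rightarrow> real" where
  "potential N K kstar \<rho> V a t =
     (\<Sum>i\<in>agents N. Vbar K kstar V (a i) t) -
     \<rho> / 2 * (\<Sum>(i, j)\<in>{(i, j). i \<in> agents N \<and> j \<in> agents N \<and> i \<noteq> j}. coupling K kstar (a i) (a j))"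

end

(* Splitting off the terms of W that involve a fixed agent i, the symmetry of C makes the two
   ordered pairs (i, j) and (j, i) cancel the factor 1/2, so W is the utility of agent i plus a
   quantity that does not depend on a_i.  Hence W and the utility change by the same amount under
   a deviation of i, and the improving deviations are the same for both. *)

theory Submission
  imports Defs
begin

lemma finite_agents [simp]: "finite (agents N)"
  by (simp add: agents_def)

lemma finite_actions [simp]: "finite (actions K)"
  by (simp add: actions_def)

lemma coupling_commute: "coupling K m k s = coupling K m s k"
  unfolding coupling_def by (metis cos_minus minus_diff_eq mult_minus_right)

lemma others_upd [simp]: "others N i (a(i := x)) = others N i a"
  by (auto simp: others_def fun_eq_iff)

text \<open>The indicator of \<open>a j = s\<close>, weighted by the coupling and summed over
  \<open>s\<close>, leaves only the coupling of \<open>k\<close> with \<open>a j\<close>. Nothing is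
  assumed about \<open>a i\<close>, so the formula also serves profiles whose entry at
  \<open>i\<close> is arbitrary.\<close>

lemma utility_eq:
  assumes "\<And>j. j \<in> agents N - {i} \<Longrightarrow> a j \<in> actions K"
  shows "utility N K m \<rho> V i k (others N i a) t =
    Vbar K m V k t - \<rho> * (\<Sum>j\<in>agents N - {i}. coupling K m k (a j))"
proof -
  have "(\<Sum>s\<in>actions K. coupling K m k s * (\<Sum>j\<in>agents N - {i}. if others N i a j = s then 1 else 0))
      = (\<Sum>s\<in>actions K. \<Sum>j\<in>agents N - {i}. if a j = s then coupling K m k s else 0)"
    by (intro sum.cong) (auto simp: sum_distrib_left others_def intro!: sum.cong split: if_splits)
  also have "\<dots> = (\<Sum>j\<in>agents N - {i}. \<Sum>s\<in>actions K. if a j = s then coupling K m k s else 0)"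
    by (rule sum.swap)
  \<comment> \<open>The inner sum collapses to its term at \<open>s = a j\<close>, which occurs
    because \<open>a j\<close> is an action.\<close>
  also have "\<dots> = (\<Sum>j\<in>agents N - {i}. coupling K m k (a j))"
    using assms by (intro sum.cong) (auto simp: sum.delta')
  finally show ?thesis
    by (simp add: utility_def evidence_def Vbar_def right_diff_distrib sum_subtractf
        mult.left_commute flip: sum_distrib_left)
qed

text \<open>The pairs that meet \<open>i\<close> form a row and a column without their common
  diagonal entry; symmetry gives both the same sum, whence the factor 2.\<close>

lemma sum_off_diagonal_remove:
  fixes f :: "'a \<Rightarrow> 'a \<Rightarrow> 'b::comm_semiring_1"
  assumes "finite S" "i \<in> S" and sym: "\<And>x y. f x y = f y x"
  shows "(\<Sum>(x, y)\<in>{(x, y). x \<in> S \<and> y \<in> S \<and> x \<noteq> y}. f x y) =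
    (\<Sum>(x, y)\<in>{(x, y). x \<in> S - {i} \<and> y \<in> S - {i} \<and> x \<noteq> y}. f x y) + 2 * (\<Sum>j\<in>S - {i}. f i j)"
proof -
  let ?P = "{(x, y). x \<in> S - {i} \<and> y \<in> S - {i} \<and> x \<noteq> y}"
  let ?R = "Pair i ` (S - {i})" and ?L = "(\<lambda>j. (j, i)) ` (S - {i})"
  let ?g = "\<lambda>(x, y). f x y"
  have fin: "finite ?P"
    by (rule finite_subset[of _ "S \<times> S"]) (use assms in auto)
  have "{(x, y). x \<in> S \<and> y \<in> S \<and> x \<noteq> y} = ?P \<union> (?R \<union> ?L)"
    using assms(2) by auto
  then have "sum ?g {(x, y). x \<in> S \<and> y \<in> S \<and> x \<noteq> y} = sum ?g (?P \<union> (?R \<union> ?L))"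
    by simp
  also have "\<dots> = sum ?g ?P + sum ?g (?R \<union> ?L)"
    using fin assms(1) by (intro sum.union_disjoint) auto
  also have "sum ?g (?R \<union> ?L) = sum ?g ?R + sum ?g ?L"
    using assms(1) by (intro sum.union_disjoint) auto
  also have "sum ?g ?R = (\<Sum>j\<in>S - {i}. f i j)"
    by (simp add: sum.reindex inj_on_def)
  \<comment> \<open>Symmetry turns the column entries \<open>f j i\<close> into the row entries
    \<open>f i j\<close>.\<close>
  also have "sum ?g ?L = (\<Sum>j\<in>S - {i}. f i j)"
    by (simp add: sum.reindex inj_on_def sym[of _ i])
  finally show ?thesis by (simp add: mult_2)
qed

text \<open>The factor 2 from the removed row and column turns \<open>\<rho> / 2\<close> into the
  weight \<open>\<rho>\<close> found in the utility.\<close>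

lemma potential_eq:
  assumes i: "i \<in> agents N" and a: "\<And>j. j \<in> agents N - {i} \<Longrightarrow> a j \<in> actions K"
  shows "potential N K m \<rho> V a t =
    (\<Sum>j\<in>agents N - {i}. Vbar K m V (a j) t) -
    \<rho> / 2 * (\<Sum>(j, k)\<in>{(j, k). j \<in> agents N - {i} \<and> k \<in> agents N - {i} \<and> j \<noteq> k}.
      coupling K m (a j) (a k)) +
    utility N K m \<rho> V i (a i) (others N i a) t"
proof -
  have "utility N K m \<rho> V i (a i) (others N i a) t =
      Vbar K m V (a i) t - \<rho> * (\<Sum>j\<in>agents N - {i}. coupling K m (a i) (a j))"
    using a by (rule utility_eq)
  then show ?thesis
    unfolding potential_def
    by (subst sum_off_diagonal_remove[OF finite_agents i coupling_commute])
      (simp add: sum.remove[OF finite_agents i] algebra_simps)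
qed

lemma potential_upd_diff:
  assumes i: "i \<in> agents N" and a: "\<And>j. j \<in> agents N - {i} \<Longrightarrow> a j \<in> actions K"
  shows "potential N K m \<rho> V (a(i := y)) t - potential N K m \<rho> V (a(i := x)) t =
    utility N K m \<rho> V i y (others N i a) t - utility N K m \<rho> V i x (others N i a) t"
proof -
  have "potential N K m \<rho> V (a(i := z)) t =
      (\<Sum>j\<in>agents N - {i}. Vbar K m V (a j) t) -
      \<rho> / 2 * (\<Sum>(j, k)\<in>{(j, k). j \<in> agents N - {i} \<and> k \<in> agents N - {i} \<and> j \<noteq> k}.
        coupling K m (a j) (a k)) +
      utility N K m \<rho> V i z (others N i a) t" for z
    by (subst potential_eq[OF i]) (use a in \<open>auto intro!: sum.cong arg_cong2[where f = "(*)"]\<close>)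
  then show ?thesis by simp
qed

lemma projected_nash_iff_local_maximizer:
  assumes a: "a \<in> profiles N K"
  shows "projected_nash N K m \<rho> V t a \<longleftrightarrow>
    local_maximizer N K (\<lambda>a. potential N K m \<rho> V a t) a"
proof -
  have act: "a j \<in> actions K" if "j \<in> agents N" for j
    using a that by (auto simp: profiles_def)
  have "utility N K m \<rho> V i (a i) (others N i a) t < utility N K m \<rho> V i x (others N i a) t
      \<longleftrightarrow> potential N K m \<rho> V a t < potential N K m \<rho> V (a(i := x)) t"
    if i: "i \<in> agents N" for i x
    \<comment> \<open>With \<open>a i\<close> as the old action, \<open>a(i := a i)\<close> is
      \<open>a\<close> itself, so the deviation is compared with the current profile.\<close>
    using potential_upd_diff[OF i, where a = a and x = "a i" and y = x
        and K = K and m = m and \<rho> = \<rho> and V = V and t = t] act by auto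
  then show ?thesis
    \<comment> \<open>Both sides now forbid the same strict improvements; \<open>is_arg_max\<close>
      also asks that \<open>a i\<close> be an action, which \<open>act\<close> supplies.\<close>
    using act by (auto simp: projected_nash_def local_maximizer_def is_arg_max_def)
qed

theorem lemma3:
  fixes N K kstar :: nat and \<rho> t :: real
    and A :: "nat \<Rightarrow> nat \<Rightarrow> real" and V :: "nat \<Rightarrow> real \<Rightarrow> real"
    and strength :: "complex \<Rightarrow> real"
  assumes "N \<ge> 1" and "K \<ge> 1" and "\<rho> > 0" and "t \<ge> 0"
    and "event_density K V"
    and "symmetric_circulant K A"
    and "strength \<in> {Re, cmod}"
    and "unique_dominant_mode strength K A kstar"
  shows "exact_potential N K (\<lambda>i a. payoff N K kstar \<rho> V i a t) (\<lambda>a. potential N K kstar \<rho> V a t)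
       \<and> (\<forall>a\<in>profiles N K.
            projected_nash N K kstar \<rho> V t a
              \<longleftrightarrow> local_maximizer N K (\<lambda>a. potential N K kstar \<rho> V a t) a)"
proof
  show "exact_potential N K (\<lambda>i a. payoff N K kstar \<rho> V i a t) (\<lambda>a. potential N K kstar \<rho> V a t)"
    unfolding exact_potential_def payoff_def
    \<comment> \<open>Here the base profile \<open>b\<close> is \<open>undefined\<close> at
      \<open>i\<close>, which is harmless since only its entries at the other agents must be
      actions.\<close>
    by (auto intro!: potential_upd_diff)
qed (simp add: projected_nash_iff_local_maximizer)

end
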